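(* For all integers $n\geq 0$, $$\overline{pl}_{4}(4n+1)+\overline{pl}_{4}(4n+2)+\overline{pl}_{4}(4n+3)\equiv 0\pmod{4}.$$
   Context: A plane partition of a positive integer $n$ is a two-dimensional array of positive integers summing to $n$, whose shape is the (left-justified) Ferrers diagram of a partition, and whose entries are non-increasing from left to right along rows and from top to bottom along columns. A plane overpartition of $n$ is a plane partition of $n$ in which entries may be overlined subject to the following: in each row, the last occurrence of an integer can be overlined or not and all the other occurrences of this integer in that row are not overlined; and in each column, the first occurrence of an integer can be overlined or not and all the other occurrences of this integer in that column are overlined. For a positive integer $k$, a $k$-rowed plane overpartition is a plane overpartition with at most $k$ rows, and $\overline{pl}_{k}(n)$ denotes the number of $k$-rowed plane overpartitions of $n$ (with $\overline{pl}_k(0)=1$). *)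

theory Defs
  imports "HOL-Number_Theory.Cong"
begin

text \<open>
  An array is the list of its rows, from top to bottom, each row being the list of its
  entries from left to right. Rows are required to be nonempty, so that every plane
  partition has exactly one such representation.
\<close>

definition cells :: "nat list list \<Rightarrow> (nat \<times> nat) set" where
  "cells A = {(i, j). i < length A \<and> j < length (A ! i)}"

definition plane_partition :: "nat list list \<Rightarrow> bool" where
  "plane_partition A \<longleftrightarrow>
     (\<forall>r \<in> set A. r \<noteq> []) \<and>
     sorted_wrt (\<ge>) (map length A) \<and>
     (\<forall>(i, j) \<in> cells A. A ! i ! j > 0) \<and>
     (\<forall>i j j'. (i, j) \<in> cells A \<longrightarrow> (i, j') \<in> cells A \<longrightarrow> j \<le> j' \<longrightarrow> A ! i ! j \<ge> A ! i ! j') \<and>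
     (\<forall>i i' j. (i, j) \<in> cells A \<longrightarrow> (i', j) \<in> cells A \<longrightarrow> i \<le> i' \<longrightarrow> A ! i ! j \<ge> A ! i' ! j)"

text \<open>
  A plane overpartition is a pair of a plane partition \<open>A\<close> and the set \<open>V\<close> of its
  overlined cells. The third conjunct is the row rule (an occurrence that is not the last one
  in its row is not overlined), the fourth one is the column rule (an occurrence that is
  not the first one in its column is overlined).
\<close>

definition plane_overpartition :: "nat list list \<times> (nat \<times> nat) set \<Rightarrow> bool" where
  "plane_overpartition = (\<lambda>(A, V).
     plane_partition A \<and>
     V \<subseteq> cells A \<and>
     (\<forall>i j j'. (i, j) \<in> cells A \<longrightarrow> (i, j') \<in> cells A \<longrightarrow> j < j' \<longrightarrow>
        A ! i ! j = A ! i ! j' \<longrightarrow> (i, j) \<notin> V) \<and>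
     (\<forall>i i' j. (i', j) \<in> cells A \<longrightarrow> (i, j) \<in> cells A \<longrightarrow> i' < i \<longrightarrow>
        A ! i' ! j = A ! i ! j \<longrightarrow> (i, j) \<in> V))"

definition plane_overpartitions :: "nat \<Rightarrow> nat \<Rightarrow> (nat list list \<times> (nat \<times> nat) set) set" where
  "plane_overpartitions k n =
     {(A, V). plane_overpartition (A, V) \<and> length A \<le> k \<and> sum_list (map sum_list A) = n}"

definition plbar :: "nat \<Rightarrow> nat \<Rightarrow> nat" where
  "plbar k n = card (plane_overpartitions k n)"

lemma finite_cells: "finite (cells A)"
proof -
  have "cells A = (SIGMA i:{..<length A}. {..<length (A ! i)})"
    by (auto simp: cells_def)
  then show ?thesis by simp
qed

lemma length_le_sum_list:
  fixes r :: "nat list"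
  assumes "\<forall>x \<in> set r. x > 0"
  shows "length r \<le> sum_list r"
  using assms by (induction r) auto

text \<open>The cardinality above is that of a finite set, so it is the intended count.\<close>

lemma finite_plane_overpartitions: "finite (plane_overpartitions k n)"
proof -
  let ?R = "{r :: nat list. set r \<subseteq> {..n} \<and> length r \<le> n}"
  let ?S = "{A. set A \<subseteq> ?R \<and> length A \<le> k}"
  have "plane_overpartitions k n \<subseteq> (SIGMA A:?S. Pow (cells A))"
  proof (rule subsetI)
    fix p assume p: "p \<in> plane_overpartitions k n"
    obtain A V where AV: "p = (A, V)" by fastforce
    from p have pp: "plane_partition A" and V: "V \<subseteq> cells A" and k: "length A \<le> k"
      and n: "sum_list (map sum_list A) = n"
      by (auto simp: AV plane_overpartitions_def plane_overpartition_def)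
    have "r \<in> ?R" if r: "r \<in> set A" for r
    proof -
      have sr: "sum_list r \<le> n"
        using member_le_sum_list[of "sum_list r" "map sum_list A"] r n by auto
      have "x > 0" if "x \<in> set r" for x
      proof -
        from r obtain i where i: "i < length A" "r = A ! i" by (metis in_set_conv_nth)
        from that obtain j where j: "j < length r" "x = r ! j" by (metis in_set_conv_nth)
        have "(i, j) \<in> cells A" using i j by (simp add: cells_def)
        then show ?thesis using pp i j by (auto simp: plane_partition_def)
      qed
      then have "length r \<le> n" using length_le_sum_list[of r] sr by fastforce
      moreover have "x \<le> n" if "x \<in> set r" for x
        using member_le_sum_list[OF that] sr by simp
      ultimately show ?thesis by auto
    qed
    then show "p \<in> (SIGMA A:?S. Pow (cells A))" using AV V k by auto
  qed
  moreover have "finite ?R" by (rule finite_lists_length_le) simp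
  then have "finite ?S" by (rule finite_lists_length_le)
  then have "finite (SIGMA A:?S. Pow (cells A))"
    by (rule finite_SigmaI) (simp add: finite_cells)
  ultimately show ?thesis by (rule finite_subset)
qed

text \<open>For \<open>n = 0\<close> only the empty array is counted, which gives the usual convention.\<close>

lemma plbar_0: "plbar k 0 = 1"
proof -
  have "A = []" if "plane_partition A" "sum_list (map sum_list A) = 0" for A
  proof (cases A)
    case (Cons r B)
    with that(1) have "r \<noteq> []" and "(0, 0) \<in> cells A"
      by (auto simp: plane_partition_def cells_def)
    with that(1) Cons have "hd r > 0" and "hd r \<in> set r"
      by (auto simp: plane_partition_def hd_conv_nth)
    with that(2) Cons show ?thesis by auto
  qed simp
  moreover have "cells [] = {}" by (simp add: cells_def)
  ultimately have "plane_overpartitions k 0 \<subseteq> {([], {})}"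
    unfolding plane_overpartitions_def plane_overpartition_def by fastforce
  moreover have "([], {}) \<in> plane_overpartitions k 0"
    by (simp add: plane_overpartitions_def plane_overpartition_def plane_partition_def cells_def)
  ultimately have "plane_overpartitions k 0 = {([], {})}" by blast
  then show ?thesis by (simp add: plbar_def)
qed

end

theory Submission
  imports Defs
begin

text \<open>
  Given the underlying plane partition, the overlining of a cell is either forced by one of the
  two rules or completely free. An array that can be overlined at all therefore has \<open>2 ^ f\<close>
  overlinings, where \<open>f\<close> is its number of free cells, and the last cell of the first row is
  always free. Hence modulo 4 only the arrays with exactly one free cell matter, each of them
  contributing 2. These are the hooks filled with a constant \<open>m\<close>, so that a hook with \<open>d\<close> cells
  requires \<open>m * d = n\<close>; as there are \<open>min d k\<close> hooks with \<open>d\<close> cells and at most \<open>k\<close> rows, the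
  count for \<open>k\<close> rows is congruent to twice the sum of \<open>min d k\<close> over the divisors \<open>d\<close> of \<open>n\<close>.
  For \<open>k = 4\<close> only \<open>d = 1\<close> and \<open>d = 3\<close> contribute modulo 4, and exactly one of three
  consecutive integers is a multiple of 3.
\<close>

section \<open>Forced and free cells of an array\<close>

definition always_overlined :: "nat list list \<Rightarrow> (nat \<times> nat) set" where
  "always_overlined A = {(i, j) \<in> cells A. \<exists>i' < i. (i', j) \<in> cells A \<and> A ! i' ! j = A ! i ! j}"

definition never_overlined :: "nat list list \<Rightarrow> (nat \<times> nat) set" where
  "never_overlined A = {(i, j) \<in> cells A. \<exists>j' > j. (i, j') \<in> cells A \<and> A ! i ! j = A ! i ! j'}"

definition free_cells :: "nat list list \<Rightarrow> (nat \<times> nat) set" where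
  "free_cells A = cells A - never_overlined A - always_overlined A"

text \<open>The two rules bound the overlined set from below and from above, so the overlinings of
  \<open>A\<close> form an interval of sets under inclusion.\<close>

lemma plane_overpartition_iff:
  "plane_overpartition (A, V) \<longleftrightarrow>
     plane_partition A \<and> always_overlined A \<subseteq> V \<and> V \<subseteq> cells A - never_overlined A"
proof -
  have "always_overlined A \<subseteq> V \<longleftrightarrow> (\<forall>i i' j. (i', j) \<in> cells A \<longrightarrow> (i, j) \<in> cells A \<longrightarrow>
      i' < i \<longrightarrow> A ! i' ! j = A ! i ! j \<longrightarrow> (i, j) \<in> V)"
    unfolding always_overlined_def by blast
  moreover have "V \<subseteq> cells A - never_overlined A \<longleftrightarrow> V \<subseteq> cells A \<and>
      (\<forall>i j j'. (i, j) \<in> cells A \<longrightarrow> (i, j') \<in> cells A \<longrightarrow> j < j' \<longrightarrow>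
        A ! i ! j = A ! i ! j' \<longrightarrow> (i, j) \<notin> V)"
    unfolding never_overlined_def by blast
  ultimately show ?thesis by (simp only: plane_overpartition_def prod.case conj_ac)
qed

lemma card_between:
  assumes "finite Y" "X \<subseteq> Y"
  shows "card {V. X \<subseteq> V \<and> V \<subseteq> Y} = 2 ^ card (Y - X)"
proof -
  have "bij_betw (\<lambda>W. X \<union> W) (Pow (Y - X)) {V. X \<subseteq> V \<and> V \<subseteq> Y}"
    by (rule bij_betw_byWitness[where f' = "\<lambda>V. V - X"]) (use assms in auto)
  then have "card {V. X \<subseteq> V \<and> V \<subseteq> Y} = card (Pow (Y - X))"
    by (simp add: bij_betw_same_card)
  then show ?thesis using assms by (simp add: card_Pow)
qed

text \<open>The existence of one overlining guarantees that no cell is forced both ways; otherwise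
  the count would be 0 instead of a power of 2.\<close>

lemma card_overlinings:
  assumes "plane_overpartition (A, V)"
  shows "card {V. plane_overpartition (A, V)} = 2 ^ card (free_cells A)"
proof -
  from assms have "plane_partition A" and "always_overlined A \<subseteq> cells A - never_overlined A"
    unfolding plane_overpartition_iff by auto
  then show ?thesis
    using card_between[of "cells A - never_overlined A" "always_overlined A"]
    by (simp add: plane_overpartition_iff free_cells_def finite_cells)
qed

text \<open>This cell has no cell above it and none to its right, so neither rule can force
  it.\<close>

lemma first_row_end_free:
  assumes "plane_partition A" "A \<noteq> []"
  shows "(0, length (A ! 0) - 1) \<in> free_cells A"
proof -
  have "A ! 0 \<noteq> []" using assms by (auto simp: plane_partition_def)
  then show ?thesis using assms(2)
    by (auto simp: free_cells_def never_overlined_def always_overlined_def cells_def)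
qed

section \<open>Hooks with constant entries\<close>

definition hook :: "nat \<Rightarrow> nat \<Rightarrow> nat \<Rightarrow> nat list list" where
  "hook a b m = replicate a m # replicate b [m]"

lemma cells_hook: "a > 0 \<Longrightarrow> (i, j) \<in> cells (hook a b m) \<longleftrightarrow> i = 0 \<and> j < a \<or> j = 0 \<and> i \<le> b"
  by (cases i) (auto simp: cells_def hook_def)

lemma nth_hook: "(i, j) \<in> cells (hook a b m) \<Longrightarrow> hook a b m ! i ! j = m"
  by (cases i) (auto simp: cells_def hook_def)

lemma sum_hook: "sum_list (map sum_list (hook a b m)) = m * (a + b)"
  by (simp add: hook_def sum_list_replicate algebra_simps)

lemma length_hook: "length (hook a b m) = Suc b"
  by (simp add: hook_def)

lemma plane_partition_hook:
  assumes "a > 0" "m > 0"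
  shows "plane_partition (hook a b m)"
proof -
  have "\<forall>r \<in> set (hook a b m). r \<noteq> []" using assms by (auto simp: hook_def)
  moreover have "sorted_wrt (\<ge>) (map length (hook a b m))"
    using assms by (auto simp: hook_def sorted_wrt_iff_nth_less Suc_le_eq nth_Cons split: nat.split)
  ultimately show ?thesis using assms(2) by (auto simp: plane_partition_def nth_hook)
qed

lemma always_overlined_hook: "a > 0 \<Longrightarrow> always_overlined (hook a b m) = {1..b} \<times> {0}"
  unfolding always_overlined_def
  \<comment> \<open>Each cell below the corner repeats the corner, which lies in row
    \<open>0\<close>.\<close>
  by (auto simp: nth_hook cong: conj_cong) (auto simp: cells_hook intro: exI[of _ 0])

lemma never_overlined_hook: "a > 0 \<Longrightarrow> never_overlined (hook a b m) = {0} \<times> {..<a - 1}"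
  unfolding never_overlined_def
  by (auto simp: nth_hook cong: conj_cong) (auto simp: cells_hook intro: exI[where x = "Suc j" for j])

lemma free_cells_hook: "a > 0 \<Longrightarrow> free_cells (hook a b m) = {(0, a - 1)}"
  by (auto simp: free_cells_def always_overlined_hook never_overlined_hook cells_hook)

text \<open>The smallest admissible overlining is taken: exactly the cells below the corner, which
  the column rule forces.\<close>

lemma plane_overpartition_hook:
  assumes "a > 0" "m > 0"
  shows "plane_overpartition (hook a b m, {1..b} \<times> {0})"
  using assms by (auto simp: plane_overpartition_iff plane_partition_hook always_overlined_hook
      never_overlined_hook cells_hook)

text \<open>The only free cell is the end of the first row, so all other cells are forced. Forcing
  carries equality along the first row and down the first column, and a second cell in a lower row
  would make some cell forced both ways.\<close>

lemma one_free_cell_imp_hook: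
  assumes po: "plane_overpartition (A, V)" and ne: "A \<noteq> []" and one: "card (free_cells A) = 1"
  obtains a b m where "a > 0" "m > 0" "A = hook a b m"
proof -
  from po have pp: "plane_partition A" and disj: "always_overlined A \<inter> never_overlined A = {}"
    unfolding plane_overpartition_iff by auto
  from pp have rowne: "A ! i \<noteq> []" if "i < length A" for i
    using that by (auto simp: plane_partition_def)
  from pp have len: "length (A ! i') \<le> length (A ! i)" if "i \<le> i'" "i' < length A" for i i'
    using that by (cases "i = i'") (auto simp: plane_partition_def sorted_wrt_iff_nth_less)
  from pp have pos: "A ! i ! j > 0" if "(i, j) \<in> cells A" for i j
    using that by (auto simp: plane_partition_def)
  from pp have row: "A ! i ! j \<ge> A ! i ! j'" if "(i, j) \<in> cells A" "(i, j') \<in> cells A" "j \<le> j'" for i j j'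
    using that unfolding plane_partition_def by blast
  from pp have col: "A ! i ! j \<ge> A ! i' ! j" if "(i, j) \<in> cells A" "(i', j) \<in> cells A" "i \<le> i'" for i i' j
    using that unfolding plane_partition_def by blast
  define a where "a = length (A ! 0)"
  define m where "m = A ! 0 ! (a - 1)"
  have a: "a > 0" using rowne[of 0] ne by (simp add: a_def)
  have c0: "(0, j) \<in> cells A \<longleftrightarrow> j < a" for j using ne by (auto simp: cells_def a_def)
  have free: "free_cells A = {(0, a - 1)}"
    using first_row_end_free[OF pp ne] one by (auto simp: a_def card_1_singleton_iff)
  \<comment> \<open>Nothing lies above the first row, so only the row rule can force its cells: each
    equals a later one, and the induction runs leftwards from the end.\<close>
  have row0: "A ! 0 ! j = m" if "j < a" for j
    using that
  proof (induction "a - j" arbitrary: j rule: less_induct)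
    case less
    show ?case
    proof (cases "j = a - 1")
      case False
      have "(0, j) \<notin> always_overlined A" by (simp add: always_overlined_def)
      moreover have "(0, j) \<notin> free_cells A" using False free by simp
      ultimately have "(0, j) \<in> never_overlined A" using less.prems c0 by (simp add: free_cells_def)
      then obtain j' where "j' > j" "j' < a" "A ! 0 ! j = A ! 0 ! j'"
        by (auto simp: never_overlined_def c0)
      then show ?thesis using less.hyps[of j'] by simp
    qed (simp add: m_def)
  qed
  \<comment> \<open>The end of a row has no right neighbour, so only the column rule can force
    it.\<close>
  have last: "(i, length (A ! i) - 1) \<in> always_overlined A" if i: "i < length A" "i > 0" for i
  proof -
    have "(i, length (A ! i) - 1) \<in> cells A" using rowne i by (simp add: cells_def)
    moreover have "(i, length (A ! i) - 1) \<notin> never_overlined A"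
      by (auto simp: never_overlined_def cells_def)
    moreover have "(i, length (A ! i) - 1) \<notin> free_cells A" using free i by simp
    ultimately show ?thesis by (simp add: free_cells_def)
  qed
  have len1: "length (A ! 1) = 1" if l: "1 < length A"
  proof (rule ccontr)
    assume "length (A ! 1) \<noteq> 1"
    define l where "l = length (A ! 1) - 1"
    have l0: "l > 0" using \<open>length (A ! 1) \<noteq> 1\<close> rowne[OF l] by (cases "A ! 1") (auto simp: l_def)
    have la: "l < a" using len[of 0 1] l l0 by (simp add: l_def a_def)
    have cl: "(1, l) \<in> cells A" "(1, 0) \<in> cells A" using l l0 by (auto simp: cells_def l_def)
    have "(1, l) \<in> always_overlined A" using last[OF l] by (simp add: l_def)
    then have "A ! 1 ! l = m" using row0[OF la] by (auto simp: always_overlined_def)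
    \<comment> \<open>The entry \<open>A ! 1 ! 0\<close> is squeezed between \<open>m\<close> above
      it and \<open>m\<close> at the end of its row, so both rules apply to it with opposite
      demands.\<close>
    moreover have "A ! 1 ! 0 \<le> m" using col[of 0 0 1] cl c0 a row0 by simp
    moreover have "A ! 1 ! l \<le> A ! 1 ! 0" using row cl by simp
    ultimately have eq: "A ! 1 ! 0 = A ! 1 ! l" "A ! 1 ! 0 = A ! 0 ! 0" using row0[OF a] by auto
    have "(1, 0) \<in> never_overlined A" using cl eq(1) l0 by (auto simp: never_overlined_def)
    moreover have "(1, 0) \<in> always_overlined A" using cl eq(2) c0 a by (auto simp: always_overlined_def)
    ultimately show False using disj by blast
  qed
  have leni: "length (A ! i) = 1" if "i < length A" "i > 0" for i
  proof -
    have "length (A ! i) \<le> 1" using len[of 1 i] len1 that by simp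
    then show ?thesis using rowne[OF that(1)] by (simp add: le_Suc_eq)
  qed
  \<comment> \<open>In a row with one cell the end is the cell of the first column, so it repeats an
    entry higher up.\<close>
  have col0: "A ! i ! 0 = m" if "i < length A" for i
    using that
  proof (induction i rule: less_induct)
    case (less i)
    show ?case
    proof (cases "i = 0")
      case False
      then have "(i, 0) \<in> always_overlined A" using last[of i] leni[of i] less.prems by simp
      then show ?thesis using less by (auto simp: always_overlined_def)
    qed (use row0 a in simp)
  qed
  have "A = hook a (length A - 1) m"
  proof (rule nth_equalityI)
    show "length A = length (hook a (length A - 1) m)" using ne by (simp add: hook_def)
    fix i assume i: "i < length A"
    show "A ! i = hook a (length A - 1) m ! i"
    proof (cases i)
      case 0
      then show ?thesis using row0 by (auto simp: hook_def a_def intro!: nth_equalityI)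
    next
      case (Suc i')
      then have "A ! i = [m]" using leni[OF i] col0[OF i] by (cases "A ! i") auto
      then show ?thesis using Suc i by (simp add: hook_def)
    qed
  qed
  moreover have "m > 0" using pos[of 0 "a - 1"] c0 a by (simp add: m_def)
  ultimately show thesis using a that by blast
qed

section \<open>Counting modulo 4\<close>

lemma card_one_free_cell:
  assumes "n > 0"
  shows "card {A \<in> fst ` plane_overpartitions k n. card (free_cells A) = 1} =
         card {(b, d). b < k \<and> b < d \<and> d dvd n}"
    (is "card ?H = card ?D")
proof -
  \<comment> \<open>Here \<open>d\<close> is the number of cells and \<open>b\<close> the number of
    cells below the corner. The hook has \<open>b + 1\<close> rows, whence \<open>b < k\<close>, and
    \<open>b < d\<close> keeps the first row nonempty.\<close>
  have "bij_betw (\<lambda>(b, d). hook (d - b) b (n div d)) ?D ?H"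
  proof (rule bij_betw_imageI)
    show "inj_on (\<lambda>(b, d). hook (d - b) b (n div d)) ?D"
    proof (rule inj_onI, clarsimp)
      fix b d b' d'
      assume *: "b < d" "b' < d'" "hook (d - b) b (n div d) = hook (d' - b') b' (n div d')"
      then have "length (hook (d - b) b (n div d)) = length (hook (d' - b') b' (n div d'))"
        "length (hook (d - b) b (n div d) ! 0) = length (hook (d' - b') b' (n div d') ! 0)"
        by simp_all
      then show "b = b' \<and> d = d'" using *(1,2) by (simp add: hook_def)
    qed
    show "(\<lambda>(b, d). hook (d - b) b (n div d)) ` ?D = ?H"
    proof (intro equalityI subsetI)
      fix A assume "A \<in> (\<lambda>(b, d). hook (d - b) b (n div d)) ` ?D"
      then obtain b d where bd: "b < k" "b < d" "d dvd n" and A: "A = hook (d - b) b (n div d)"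
        by auto
      have "n div d > 0" using bd assms by (simp add: div_greater_zero_iff dvd_imp_le)
      then have "(A, {1..b} \<times> {0}) \<in> plane_overpartitions k n"
        using bd plane_overpartition_hook[of "d - b" "n div d" b] sum_hook[of "d - b" b "n div d"]
        by (simp add: plane_overpartitions_def A length_hook)
      then have "A \<in> fst ` plane_overpartitions k n" by (rule image_eqI[rotated]) simp
      then show "A \<in> ?H" using bd by (simp add: A free_cells_hook)
    next
      fix A assume A: "A \<in> ?H"
      then obtain V where V: "plane_overpartition (A, V)" "length A \<le> k"
        "sum_list (map sum_list A) = n" by (auto simp: plane_overpartitions_def)
      have "A \<noteq> []" "card (free_cells A) = 1" using V(3) assms A by auto
      then obtain a b m where h: "a > 0" "m > 0" "A = hook a b m"
        by (rule one_free_cell_imp_hook[OF V(1)])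
      have n: "n = m * (a + b)" using V(3) sum_hook h(3) by simp
      have "A = hook (a + b - b) b (n div (a + b))" using h(1) by (simp add: n h(3))
      moreover have "b < k" using V(2) by (simp add: h(3) length_hook)
      ultimately show "A \<in> (\<lambda>(b, d). hook (d - b) b (n div d)) ` ?D"
        using h(1) by (intro image_eqI[where x = "(b, a + b)"]) (simp_all add: n)
    qed
  qed
  then show ?thesis by (simp add: bij_betw_same_card)
qed

lemma plbar_cong_mod_4:
  assumes "n > 0"
  shows "[plbar k n = 2 * card {(b, d). b < k \<and> b < d \<and> d dvd n}] (mod 4)"
proof -
  let ?P = "fst ` plane_overpartitions k n"
  have fin: "finite ?P" by (simp add: finite_plane_overpartitions)
  \<comment> \<open>The bounds on rows and sum concern only the array, so every overlining of an
    array in \<open>?P\<close> is counted.\<close>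
  have "plane_overpartitions k n = (SIGMA A:?P. {V. plane_overpartition (A, V)})"
    by (force simp: plane_overpartitions_def)
  moreover have "finite {V. plane_overpartition (A, V)}" for A
    by (rule finite_subset[of _ "Pow (cells A)"])
      (auto simp: plane_overpartition_iff finite_cells)
  then have "card (SIGMA A:?P. {V. plane_overpartition (A, V)}) =
      (\<Sum>A\<in>?P. card {V. plane_overpartition (A, V)})"
    using fin by (intro card_SigmaI) auto
  ultimately have "plbar k n = (\<Sum>A\<in>?P. card {V. plane_overpartition (A, V)})"
    unfolding plbar_def by (rule trans[OF arg_cong])
  also have "\<dots> = (\<Sum>A\<in>?P. 2 ^ card (free_cells A))"
    by (rule sum.cong) (auto simp: plane_overpartitions_def card_overlinings)
  also have "[\<dots> = (\<Sum>A\<in>?P. if card (free_cells A) = 1 then 2 else 0)] (mod 4)"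
  proof (rule cong_sum)
    fix A assume "A \<in> ?P"
    then obtain V where V: "plane_overpartition (A, V)" "sum_list (map sum_list A) = n"
      by (auto simp: plane_overpartitions_def)
    then have "A \<noteq> []" and "plane_partition A"
      using assms by (auto simp: plane_overpartition_iff)
    then have "free_cells A \<noteq> {}" using first_row_end_free by blast
    moreover have "finite (free_cells A)" by (simp add: free_cells_def finite_cells)
    ultimately have "card (free_cells A) > 0" by (simp add: card_gt_0_iff)
    \<comment> \<open>An exponent of at least 2 makes the power of 2 vanish modulo 4.\<close>
    then have "card (free_cells A) = 1 \<or> (\<exists>e. card (free_cells A) = e + 2)" by presburger
    then show "[2 ^ card (free_cells A) = (if card (free_cells A) = 1 then 2 else 0)] (mod (4::nat))"
      by (auto simp: cong_def power_add)
  qed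
  also have "(\<Sum>A\<in>?P. if card (free_cells A) = 1 then 2 else 0) =
      2 * card {A \<in> ?P. card (free_cells A) = 1}"
    using fin by (simp add: sum.If_cases Int_def)
  finally show ?thesis by (simp only: card_one_free_cell[OF assms])
qed

text \<open>For a fixed divisor \<open>d\<close>, the values \<open>b\<close> are those below both
  \<open>d\<close> and \<open>k\<close>.\<close>

lemma card_arms_of_hooks:
  assumes "n > (0 :: nat)"
  shows "card {(b, d). b < k \<and> b < d \<and> d dvd n} = (\<Sum>d | d dvd n. min d k)"
proof -
  have "{(b, d). b < k \<and> b < d \<and> d dvd n} = prod.swap ` (SIGMA d:{d. d dvd n}. {..<min d k})"
    by (auto simp: image_def)
  then show ?thesis using assms by (simp add: card_image)
qed

section \<open>The case of four rows\<close>

lemma plbar_4_cong_mod_4: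
  assumes "n > 0"
  shows "[plbar 4 n = 2 + (if 3 dvd n then 2 else 0)] (mod 4)"
proof -
  have fin: "finite {d. d dvd n}" using assms by simp
  have "[(\<Sum>d | d dvd n. min d 4) = (\<Sum>d | d dvd n. (if d = 1 then 1 else 0) + (if d = 3 then 1 else 0))] (mod 2)"
  proof (rule cong_sum)
    fix d assume "d \<in> {d. d dvd n}"
    then have "d > 0" using assms by (auto intro: Nat.gr0I)
    \<comment> \<open>\<open>min d 4\<close> is odd only for \<open>d = 1\<close> and
      \<open>d = 3\<close>; from \<open>4\<close> on it is constantly 4.\<close>
    then consider "d = 1" | "d = 2" | "d = 3" | "d \<ge> 4" by linarith
    then show "[min d 4 = (if d = 1 then 1 else 0) + (if d = 3 then 1 else 0)] (mod 2)"
      by cases (auto simp: cong_def)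
  qed
  moreover have "(\<Sum>d | d dvd n. (if d = 1 then 1 else 0) + (if d = 3 then 1 else 0)) =
      (1 + (if 3 dvd n then 1 else 0) :: nat)"
    using fin by (simp add: sum.distrib)
  \<comment> \<open>Doubling turns the parity of the divisor sum into a residue modulo 4.\<close>
  moreover have "2 * x mod 4 = 2 * (x mod 2)" for x :: nat by (simp add: mult_mod_right)
  ultimately have "[2 * (\<Sum>d | d dvd n. min d 4) = 2 * (1 + (if 3 dvd n then 1 else 0))] (mod 4)"
    by (simp only: cong_def)
  then show ?thesis
    using plbar_cong_mod_4[OF assms, of 4] card_arms_of_hooks[OF assms, of 4]
    by (auto simp: cong_def)
qed

theorem theorem3p5:
  fixes n :: nat
  shows "[plbar 4 (4 * n + 1) + plbar 4 (4 * n + 2) + plbar 4 (4 * n + 3) = 0] (mod 4)"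
proof -
  let ?t = "\<lambda>m. 2 + (if 3 dvd m then 2 else 0 :: nat)"
  have "[plbar 4 (4 * n + 1) + plbar 4 (4 * n + 2) + plbar 4 (4 * n + 3) =
      ?t (4 * n + 1) + ?t (4 * n + 2) + ?t (4 * n + 3)] (mod 4)"
    by (intro cong_add plbar_4_cong_mod_4) simp_all
  also have "?t (4 * n + 1) + ?t (4 * n + 2) + ?t (4 * n + 3) = 8"
  proof -
    \<comment> \<open>As 4 is 1 modulo 3, the residue of \<open>n\<close> selects the one multiple
      of 3, which contributes 4 while the other two terms contribute 2 each.\<close>
    have "3 dvd 4 * n + 1 \<longleftrightarrow> n mod 3 = 2" "3 dvd 4 * n + 2 \<longleftrightarrow> n mod 3 = 1"
      "3 dvd 4 * n + 3 \<longleftrightarrow> n mod 3 = 0" by presburger+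
    moreover have "n mod 3 = 0 \<or> n mod 3 = 1 \<or> n mod 3 = 2" by presburger
    ultimately show ?thesis by (elim disjE) simp_all
  qed
  finally show ?thesis by (simp add: cong_def)
qed

end
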